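(* Let $\mathbb{U}$ be a convex subset of a Euclidean space and consider an irreducible positive linear system $\dot x = A(u)x$, $x(0)=x_0$, $y = cx$, where, for each $u\in\mathbb{U}$, $A(u)\in\mathbb{R}^{n\times n}$ is an irreducible Metzler matrix, and $c=(c_1,\ldots,c_n)$ is a row vector with all entries strictly positive. Let $u_1,u_2\in\mathbb{U}$ and let $0<\alpha<1$. Then for every initial state $x_0$ with all coordinates strictly positive, the limit $$\rho(u_1,u_2,\alpha)=\lim_{t\to+\infty}\frac1t\ln y(t,u_1,u_2,x_0)$$ defining the logarithmic rate for the sequential application of the inputs $u_1$ and $u_2$ exists, and $$\rho(u_1,u_2,\alpha)=\alpha\,\lambda_F(u_1)+(1-\alpha)\,\lambda_F(u_2).$$
   Context: For $u\in\mathbb{U}$ (constant in time) and $x_0\in\mathbb{R}^n$ with strictly positive coordinates, $x(t,u,x_0)$ denotes the solution at time $t\ge0$ of $\dot x=A(u)x$, $x(0)=x_0$. Sequential inputs: with $\beta=1-\alpha$, for each total time $t>0$ the input $u_1$ is first applied for a duration $\alpha t$, and then the input $u_2$ is applied for a duration $\beta t$. The resulting state at time $t$ is $$x(t,u_1,u_2,x_0):=x\big(\beta t,\,u_2,\,x(\alpha t,u_1,x_0)\big),$$ and the resulting output is $y(t,u_1,u_2,x_0):=c\,x(t,u_1,u_2,x_0)$. The logarithmic rate for the sequential application of inputs is $\rho(u_1,u_2,\alpha):=\lim_{t\to+\infty}\frac1t\ln y(t,u_1,u_2,x_0)$, if the limit exists. Metzler matrix: a real square matrix whose off-diagonal entries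 are all nonnegative (diagonal entries are arbitrary real numbers). Irreducible (the paper's definition, for a Metzler matrix $A$): for some $r\in\mathbb{R}$ and some positive integer $k$, the matrix $(rI+A)^k$ has all entries strictly positive. Frobenius eigenvalue: for an irreducible Metzler matrix $A$, it is known that there is a real eigenvalue $\lambda_F$ of $A$, of algebraic multiplicity one, such that every other eigenvalue has real part strictly less than $\lambda_F$; this is the Frobenius eigenvalue. $\lambda_F(u)$ denotes the Frobenius eigenvalue of $A(u)$. *)

theory Defs
  imports "HOL-Analysis.Analysis" "HOL-Computational_Algebra.Polynomial"
begin

definition metzler :: "real^'n^'n \<Rightarrow> bool" where
  "metzler M \<longleftrightarrow> (\<forall>i j. i \<noteq> j \<longrightarrow> 0 \<le> M $ i $ j)"

(* The library power on vectors of vectors is entrywise; this is the power for the matrix product. *)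
definition mat_pow :: "'a::semiring_1^'n^'n \<Rightarrow> nat \<Rightarrow> 'a^'n^'n" where
  "mat_pow M k = (((**) M) ^^ k) (mat 1)"

definition irreducible_matrix :: "real^'n^'n \<Rightarrow> bool" where
  "irreducible_matrix M \<longleftrightarrow>
     (\<exists>r. \<exists>k>0. \<forall>i j. 0 < mat_pow (mat r + M) k $ i $ j)"

definition mat_eigenvalue :: "'a::field^'n^'n \<Rightarrow> 'a \<Rightarrow> bool" where
  "mat_eigenvalue M l \<longleftrightarrow> (\<exists>v. v \<noteq> 0 \<and> M *v v = l *s v)"

(* det (x I - M), computed in the polynomial ring *)
definition mat_charpoly :: "'a::comm_ring_1^'n^'n \<Rightarrow> 'a poly" where
  "mat_charpoly M = det (mat [:0, 1:] - map_matrix (\<lambda>a. [:a:]) M)"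

definition alg_multiplicity :: "'a::field^'n^'n \<Rightarrow> 'a \<Rightarrow> nat" where
  "alg_multiplicity M l = order l (mat_charpoly M)"

definition is_frobenius_eigenvalue :: "real^'n^'n \<Rightarrow> real \<Rightarrow> bool" where
  "is_frobenius_eigenvalue M l \<longleftrightarrow>
     (let C = map_matrix complex_of_real M in
        mat_eigenvalue C (complex_of_real l) \<and>
        alg_multiplicity C (complex_of_real l) = 1 \<and>
        (\<forall>z. mat_eigenvalue C z \<and> z \<noteq> complex_of_real l \<longrightarrow> Re z < l))"

lemma is_frobenius_eigenvalue_unique:
  assumes "is_frobenius_eigenvalue M l" and "is_frobenius_eigenvalue M l'"
  shows "l = l'"
proof (rule ccontr)
  assume "l \<noteq> l'"
  with assms have "l < l'" "l' < l"
    unfolding is_frobenius_eigenvalue_def Let_def by force+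
  then show False by simp
qed

definition frobenius_eigenvalue :: "real^'n^'n \<Rightarrow> real" where
  "frobenius_eigenvalue M = (THE l. is_frobenius_eigenvalue M l)"

definition lin_ode_solution :: "real^'n^'n \<Rightarrow> real^'n \<Rightarrow> (real \<Rightarrow> real^'n) \<Rightarrow> bool" where
  "lin_ode_solution M x0 \<phi> \<longleftrightarrow>
     \<phi> 0 = x0 \<and>
     (\<forall>s\<ge>0. (\<phi> has_vector_derivative M *v \<phi> s) (at s within {0..}))"

(* Solutions are only determined on {0..}, so the description picks the value at t (meant for
   t \<ge> 0) and not the function. *)
definition state :: "('u \<Rightarrow> real^'n^'n) \<Rightarrow> real \<Rightarrow> 'u \<Rightarrow> real^'n \<Rightarrow> real^'n" where
  "state A t u x0 = (THE z. \<exists>\<phi>. lin_ode_solution (A u) x0 \<phi> \<and> z = \<phi> t)"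

definition seq_state ::
  "('u \<Rightarrow> real^'n^'n) \<Rightarrow> real \<Rightarrow> real \<Rightarrow> 'u \<Rightarrow> 'u \<Rightarrow> real^'n \<Rightarrow> real^'n" where
  "seq_state A \<alpha> t u\<^sub>1 u\<^sub>2 x0 = state A ((1 - \<alpha>) * t) u\<^sub>2 (state A (\<alpha> * t) u\<^sub>1 x0)"

definition seq_output ::
  "('u \<Rightarrow> real^'n^'n) \<Rightarrow> real^'n \<Rightarrow> real \<Rightarrow> real \<Rightarrow> 'u \<Rightarrow> 'u \<Rightarrow> real^'n \<Rightarrow> real" where
  "seq_output A c \<alpha> t u\<^sub>1 u\<^sub>2 x0 = c \<bullet> seq_state A \<alpha> t u\<^sub>1 u\<^sub>2 x0"

end

theory Submission
  imports Defs
begin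

text \<open>
  By Brouwer's theorem on the simplex, an irreducible Metzler matrix \<open>M\<close> and its transpose have
  nonnegative eigenvectors, which irreducibility makes strictly positive; pairing them shows that
  they share one eigenvalue \<open>l\<close>. Weighting moduli with the left eigenvector bounds every other
  eigenvalue, and the equality case of this bound makes \<open>l\<close> simple, so \<open>l\<close> is the Frobenius
  eigenvalue. The flow of a Metzler matrix preserves the positive orthant, hence the order, so an
  initial state squeezed between multiples of the right eigenvector \<open>v\<close> stays squeezed between the
  same multiples of \<open>exp (l * t) *\<^sub>R v\<close>. Applying this to the two inputs in turn confines the output
  between constant multiples of one exponential.
\<close>

section \<open>Perron vectors of irreducible Metzler matrices\<close>

text \<open>In graph terms no edge leads from \<open>Z\<close> to its complement, so no path of
  length \<open>k\<close> does either. The induction peels off the first step of the path.\<close>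

lemma mat_pow_zero_block:
  fixes M :: "'a::semiring_1^'n^'n"
  assumes block: "\<And>i j. i \<in> Z \<Longrightarrow> j \<notin> Z \<Longrightarrow> M $ i $ j = 0"
    and "i \<in> Z" "j \<notin> Z"
  shows "mat_pow M k $ i $ j = 0"
  using assms(2)
proof (induction k arbitrary: i)
  case 0
  with \<open>j \<notin> Z\<close> show ?case by (auto simp: mat_pow_def mat_def)
next
  case (Suc k)
  have "mat_pow M (Suc k) $ i $ j = (\<Sum>l\<in>UNIV. M $ i $ l * mat_pow M k $ l $ j)"
    by (simp add: mat_pow_def matrix_matrix_mult_def)
  also have "\<dots> = 0"
  proof (rule sum.neutral, rule ballI)
    fix l
    show "M $ i $ l * mat_pow M k $ l $ j = 0"
      using Suc block[of i l] by (cases "l \<in> Z") auto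
  qed
  finally show ?case .
qed

text \<open>Unlike the power criterion in the definition of irreducibility, this is visibly invariant
  under transposition.\<close>
definition no_zero_block :: "real^'n^'n \<Rightarrow> bool" where
  "no_zero_block M \<longleftrightarrow> (\<forall>Z. Z \<noteq> {} \<and> Z \<noteq> UNIV \<longrightarrow> (\<exists>i\<in>Z. \<exists>j. j \<notin> Z \<and> M $ i $ j \<noteq> 0))"

text \<open>Adding \<open>mat r\<close> changes only the diagonal, which a block with rows in
  \<open>Z\<close> and columns outside \<open>Z\<close> never meets. Such a zero block would survive
  in every power of \<open>mat r + M\<close> and contradict positivity.\<close>

lemma irreducible_no_zero_block:
  fixes M :: "real^'n^'n"
  assumes "irreducible_matrix M"
  shows "no_zero_block M"
  unfolding no_zero_block_def
proof (intro allI impI, rule ccontr)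
  fix Z :: "'n set"
  assume Z: "Z \<noteq> {} \<and> Z \<noteq> UNIV"
    and "\<not> (\<exists>i\<in>Z. \<exists>j. j \<notin> Z \<and> M $ i $ j \<noteq> 0)"
  then have block: "M $ i $ j = 0" if "i \<in> Z" "j \<notin> Z" for i j
    using that by blast
  obtain r k where pos: "\<And>i j. 0 < mat_pow (mat r + M) k $ i $ j"
    using assms by (auto simp: irreducible_matrix_def)
  obtain i j where ij: "i \<in> Z" "j \<notin> Z" using Z by auto
  have "mat_pow (mat r + M) k $ i $ j = 0"
    by (rule mat_pow_zero_block[of Z, OF _ ij]) (auto simp: mat_def block)
  with pos[of i j] show False by simp
qed

text \<open>Transposition exchanges the block of \<open>Z\<close> with that of its complement, so
  the criterion is applied to \<open>- Z\<close>.\<close>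

lemma no_zero_block_transpose:
  fixes M :: "real^'n^'n"
  assumes "no_zero_block M"
  shows "no_zero_block (transpose M)"
  unfolding no_zero_block_def
proof (intro allI impI)
  fix Z :: "'n set"
  assume Z: "Z \<noteq> {} \<and> Z \<noteq> UNIV"
  then have "- Z \<noteq> {} \<and> - Z \<noteq> UNIV" by auto
  with assms have "\<exists>i\<in>- Z. \<exists>j. j \<notin> - Z \<and> M $ i $ j \<noteq> 0"
    unfolding no_zero_block_def by (elim allE[of _ "- Z"]) auto
  then show "\<exists>i\<in>Z. \<exists>j. j \<notin> Z \<and> transpose M $ i $ j \<noteq> 0"
    by (auto simp: transpose_def)
qed

lemma metzler_transpose: "metzler M \<Longrightarrow> metzler (transpose M)"
  by (auto simp: metzler_def transpose_def)

text \<open>On the zero set \<open>Z\<close> of \<open>x\<close>, each row of the eigenvector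
  equation is a vanishing sum of nonnegative terms; the diagonal term, whose sign is unknown, drops
  out because \<open>x\<close> is zero there. Hence \<open>M\<close> has a zero block from
  \<open>Z\<close> to its complement.\<close>

lemma nonneg_eigenvector_pos:
  fixes M :: "real^'n^'n"
  assumes "metzler M" "no_zero_block M"
    and nn: "\<And>i. 0 \<le> x $ i" and "x \<noteq> 0" and eig: "M *v x = l *\<^sub>R x"
  shows "0 < x $ i"
proof (rule ccontr)
  assume "\<not> 0 < x $ i"
  define Z where "Z = {i. x $ i = 0}"
  have "i \<in> Z" using nn[of i] \<open>\<not> 0 < x $ i\<close> by (simp add: Z_def)
  moreover have "Z \<noteq> UNIV" using \<open>x \<noteq> 0\<close> by (auto simp: Z_def vec_eq_iff)
  ultimately obtain j k where jk: "j \<in> Z" "k \<notin> Z" "M $ j $ k \<noteq> 0"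
    using \<open>no_zero_block M\<close> unfolding no_zero_block_def by blast
  have "(\<Sum>m\<in>UNIV. M $ j $ m * x $ m) = l * x $ j"
    using arg_cong[OF eig, of "\<lambda>v. v $ j"] by (simp add: matrix_vector_mult_def)
  then have s0: "(\<Sum>m\<in>UNIV. M $ j $ m * x $ m) = 0" using \<open>j \<in> Z\<close> by (simp add: Z_def)
  have "M $ j $ m * x $ m \<ge> 0" for m
  proof (cases "m = j")
    case True then show ?thesis using \<open>j \<in> Z\<close> by (simp add: Z_def)
  next
    case False then show ?thesis using nn[of m] \<open>metzler M\<close> by (simp add: metzler_def)
  qed
  then have "M $ j $ k * x $ k = 0"
    using s0 sum_nonneg_eq_0_iff[of UNIV "\<lambda>m. M $ j $ m * x $ m"] by simp
  then show False using jk by (simp add: Z_def)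
qed

text \<open>Shifting by a multiple of the identity keeps eigenvectors and makes tools for
  nonnegative matrices available. The bound 1 on the diagonal keeps the normalising factor in the
  Brouwer argument away from zero.\<close>

lemma metzler_nonneg_shift:
  assumes "metzler (M :: real^'n^'n)"
  obtains s where "\<And>i j. 0 \<le> (mat s + M) $ i $ j" "\<And>i. 1 \<le> (mat s + M) $ i $ i"
proof
  define s where "s = 1 + (\<Sum>i\<in>UNIV. \<bar>M $ i $ i\<bar>)"
  have "\<bar>M $ i $ i\<bar> \<le> (\<Sum>i\<in>UNIV. \<bar>M $ i $ i\<bar>)" for i
    by (rule member_le_sum) auto
  then have *: "1 \<le> s + M $ i $ i" for i
    unfolding s_def by (smt (verit))
  then show "1 \<le> (mat s + M) $ i $ i" for i by (simp add: mat_def)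
  show "0 \<le> (mat s + M) $ i $ j" for i j
    using assms *[of i] by (cases "i = j") (auto simp: mat_def metzler_def)
qed

lemma mat_shift_mult: "(mat s + M) *v x = s *\<^sub>R x + M *v (x :: real^'n)"
  by (simp add: vec_eq_iff mat_def matrix_vector_mult_def distrib_right sum.distrib
      if_distrib[of "\<lambda>a. a * _"] cong: if_cong)

text \<open>A fixed point of the normalised map \<open>f\<close> on the simplex \<open>S\<close> is
  an eigenvector of the shifted matrix \<open>B\<close>, hence of \<open>M\<close>. Since
  \<open>B *v x\<close> dominates \<open>x\<close> entrywise on \<open>S\<close>, the denominator is
  at least 1 and \<open>f\<close> is continuous.\<close>

lemma metzler_nonneg_eigenvector:
  assumes "metzler (M :: real^'n^'n)"
  obtains v l where "\<And>i. 0 \<le> v $ i" "v \<noteq> 0" "M *v v = l *\<^sub>R v"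
proof -
  obtain s where s: "\<And>i j. 0 \<le> (mat s + M) $ i $ j" "\<And>i. 1 \<le> (mat s + M) $ i $ i"
    using metzler_nonneg_shift[OF assms] by metis
  define B where "B = mat s + M"
  define total where "total = (\<lambda>x :: real^'n. \<Sum>i\<in>UNIV. x $ i)"
  define S where "S = {x :: real^'n. (\<forall>i. 0 \<le> x $ i) \<and> total x = 1}"
  define f where "f = (\<lambda>x. (1 / total (B *v x)) *\<^sub>R (B *v x))"
  have lower: "x $ i \<le> (B *v x) $ i" if "x \<in> S" for x i
  proof -
    have "x $ i \<le> B $ i $ i * x $ i"
      using mult_right_mono[of 1 "B $ i $ i" "x $ i"] s(2)[of i] that by (simp add: B_def S_def)
    also have "\<dots> \<le> (\<Sum>j\<in>UNIV. B $ i $ j * x $ j)"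
      by (rule member_le_sum) (use s(1) that in \<open>auto simp: B_def S_def\<close>)
    finally show ?thesis by (simp add: matrix_vector_mult_def)
  qed
  have total: "1 \<le> total (B *v x)" if "x \<in> S" for x
  proof -
    have "total x \<le> total (B *v x)" unfolding total_def by (intro sum_mono lower that)
    with that show ?thesis by (simp add: S_def)
  qed
  have lin: "linear total"
    by (simp add: total_def linear_iff sum.distrib sum_distrib_left)
  have "convex S"
    unfolding convex_def S_def using lin
    by (auto simp: linear_add linear_scale)
  moreover have "S \<noteq> {}"
  proof -
    \<comment> \<open>Any vertex of the simplex will do; \<open>undefined\<close> is merely some
      index.\<close>
    have "(axis undefined 1 :: real^'n) \<in> S"
      by (auto simp: S_def total_def axis_def)
    then show ?thesis by blast
  qed
  moreover have "compact S"
  proof -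
    have "norm x \<le> 1" if "x \<in> S" for x
      using norm_le_l1_cart[of x] that by (simp add: S_def total_def)
    then have "bounded S" by (auto simp: bounded_iff)
    moreover have "closed S"
    proof -
      have "S = (\<Inter>i. {x. 0 \<le> x $ i}) \<inter> {x. total x = 1}" by (auto simp: S_def)
      moreover have "closed {x :: real^'n. 0 \<le> x $ i}" for i
        by (intro closed_Collect_le continuous_intros)
      moreover have "closed {x. total x = 1}"
        unfolding total_def by (intro closed_Collect_eq continuous_intros)
      ultimately show ?thesis by (simp add: closed_INT closed_Int)
    qed
    ultimately show ?thesis by (simp add: compact_eq_bounded_closed)
  qed
  moreover have "continuous_on S f"
  proof -
    have "continuous_on S (\<lambda>x. total (B *v x))"
      unfolding total_def
      by (intro continuous_on_sum continuous_on_component matrix_vector_mult_linear_continuous_on)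
    moreover have "total (B *v x) \<noteq> 0" if "x \<in> S" for x using total[OF that] by linarith
    ultimately show ?thesis
      unfolding f_def by (intro continuous_intros matrix_vector_mult_linear_continuous_on) auto
  qed
  moreover have "f \<in> S \<rightarrow> S"
  proof
    fix x assume x: "x \<in> S"
    have "0 \<le> (B *v x) $ i" for i
      using lower[OF x, of i] x by (smt (verit) S_def mem_Collect_eq)
    then show "f x \<in> S"
      using total[OF x] lin by (auto simp: f_def S_def linear_scale)
  qed
  ultimately obtain v where v: "v \<in> S" "f v = v"
    using brouwer by metis
  show thesis
  proof
    show "0 \<le> v $ i" for i using v by (simp add: S_def)
    show "v \<noteq> 0" using v by (auto simp: S_def total_def)
    have "B *v v = total (B *v v) *\<^sub>R f v"
      using total[OF v(1)] by (simp add: f_def)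
    then have "s *\<^sub>R v + M *v v = total (B *v v) *\<^sub>R v"
      by (simp add: v(2) B_def mat_shift_mult)
    then show "M *v v = (total (B *v v) - s) *\<^sub>R v"
      by (simp add: algebra_simps)
  qed
qed

lemma perron_vectors:
  fixes M :: "real^'n^'n"
  assumes "metzler M" "no_zero_block M"
  obtains v w l where "\<And>i. 0 < v $ i" "M *v v = l *\<^sub>R v" "\<And>i. 0 < w $ i" "w v* M = l *\<^sub>R w"
proof -
  obtain v l where v: "\<And>i. 0 \<le> v $ i" "v \<noteq> 0" "M *v v = l *\<^sub>R v"
    using metzler_nonneg_eigenvector[OF assms(1)] by metis
  have vp: "0 < v $ i" for i using nonneg_eigenvector_pos[OF assms v] .
  obtain w m where w: "\<And>i. 0 \<le> w $ i" "w \<noteq> 0" "transpose M *v w = m *\<^sub>R w"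
    using metzler_nonneg_eigenvector[OF metzler_transpose[OF assms(1)]] by metis
  have wp: "0 < w $ i" for i
    using nonneg_eigenvector_pos[OF metzler_transpose[OF assms(1)]
        no_zero_block_transpose[OF assms(2)] w] .
  have wM: "w v* M = m *\<^sub>R w" using w(3) by simp
  \<comment> \<open>Evaluating \<open>w\<close> against \<open>M *v v\<close> from either side
    identifies the two eigenvalues, since \<open>w \<bullet> v\<close> is positive.\<close>
  have "m * (w \<bullet> v) = l * (w \<bullet> v)"
    using dot_lmul_matrix[of w M v] by (simp add: wM v(3))
  moreover have "w \<bullet> v > 0"
    unfolding inner_vec_def by (rule sum_pos) (auto simp: vp wp)
  ultimately have "m = l" by simp
  with vp v(3) wp wM show thesis by (intro that[of v l w]) auto
qed

section \<open>Spectral bounds from the positive left eigenvector\<close>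

lemma left_eigenvector_sum:
  assumes "w v* M = l *\<^sub>R (w :: real^'n)"
  shows "(\<Sum>i\<in>UNIV. w $ i * (M *v y) $ i) = l * (\<Sum>i\<in>UNIV. w $ i * y $ i)"
  using dot_lmul_matrix[of w M y] assms by (simp add: inner_vec_def sum_distrib_left mult.assoc)

text \<open>This is the triangle inequality in one row of the shifted eigenvector equation. The
  shift makes every coefficient, including the diagonal one, equal to its own modulus.\<close>

lemma complex_eigenvector_norm_le:
  fixes z :: "complex^'n"
  assumes shift: "\<And>i j. 0 \<le> (mat s + M) $ i $ j"
    and eig: "map_matrix complex_of_real M *v z = \<zeta> *s z"
  shows "cmod (complex_of_real s + \<zeta>) * cmod (z $ i)
     \<le> s * cmod (z $ i) + (M *v (\<chi> j. cmod (z $ j))) $ i"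
proof -
  have "(complex_of_real s + \<zeta>) * z $ i = of_real s * z $ i + (\<Sum>j\<in>UNIV. of_real (M $ i $ j) * z $ j)"
    using arg_cong[OF eig, of "\<lambda>v. v $ i"] by (simp add: matrix_vector_mult_def distrib_right)
  also have "\<dots> = (\<Sum>j\<in>UNIV. of_real ((mat s + M) $ i $ j) * z $ j)"
    by (simp add: mat_def if_distrib[of of_real] if_distrib[of "\<lambda>a. a * _"] distrib_right
        sum.distrib cong: if_cong)
  finally have "cmod (complex_of_real s + \<zeta>) * cmod (z $ i)
     = cmod (\<Sum>j\<in>UNIV. of_real ((mat s + M) $ i $ j) * z $ j)"
    by (metis norm_mult)
  also have "\<dots> \<le> (\<Sum>j\<in>UNIV. cmod (of_real ((mat s + M) $ i $ j) * z $ j))"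
    by (rule norm_sum)
  also have "\<dots> = (\<Sum>j\<in>UNIV. (mat s + M) $ i $ j * cmod (z $ j))"
    by (rule sum.cong) (use shift in \<open>auto simp: norm_mult simp del: vector_add_component\<close>)
  also have "\<dots> = ((mat s + M) *v (\<chi> j. cmod (z $ j))) $ i"
    by (simp add: matrix_vector_mult_def)
  also have "\<dots> = s * cmod (z $ i) + (M *v (\<chi> j. cmod (z $ j))) $ i"
    by (simp add: mat_shift_mult)
  finally show ?thesis .
qed

text \<open>Summing the row inequalities with weights \<open>w\<close> turns \<open>M *v y\<close>
  into \<open>l\<close> times the weighted sum \<open>W\<close> of moduli, and \<open>W\<close>
  cancels because it is positive.\<close>

lemma complex_eigenvalue_le:
  fixes z :: "complex^'n"
  assumes shift: "\<And>i j. 0 \<le> (mat s + M) $ i $ j"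
    and w: "\<And>i. 0 < w $ i" "w v* M = l *\<^sub>R w"
    and eig: "map_matrix complex_of_real M *v z = \<zeta> *s z" and "z \<noteq> 0"
  shows "cmod (complex_of_real s + \<zeta>) \<le> s + l"
proof -
  define y where "y = (\<chi> j. cmod (z $ j))"
  define W where "W = (\<Sum>i\<in>UNIV. w $ i * y $ i)"
  obtain k where "z $ k \<noteq> 0" using \<open>z \<noteq> 0\<close> by (auto simp: vec_eq_iff)
  then have "0 < W"
    unfolding W_def by (intro sum_pos2[of _ k]) (auto simp: y_def w less_imp_le)
  have "cmod (complex_of_real s + \<zeta>) * W = (\<Sum>i\<in>UNIV. w $ i * (cmod (complex_of_real s + \<zeta>) * y $ i))"
    by (simp add: W_def sum_distrib_left mult_ac)
  also have "\<dots> \<le> (\<Sum>i\<in>UNIV. w $ i * (s * y $ i + (M *v y) $ i))"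
    using complex_eigenvector_norm_le[OF shift eig]
    by (intro sum_mono mult_left_mono) (auto simp: y_def w less_imp_le)
  also have "\<dots> = s * W + (\<Sum>i\<in>UNIV. w $ i * (M *v y) $ i)"
    by (simp add: W_def distrib_left sum.distrib sum_distrib_left mult_ac)
  also have "\<dots> = (s + l) * W"
    by (simp only: left_eigenvector_sum[OF w(2)] W_def distrib_right)
  finally show ?thesis using \<open>0 < W\<close> by simp
qed

text \<open>The disc of radius \<open>s + l\<close> about \<open>- s\<close> touches the vertical
  line through \<open>l\<close> only at \<open>l\<close> itself and otherwise lies to its
  left.\<close>

lemma complex_eigenvalue_Re_less:
  fixes z :: "complex^'n"
  assumes "metzler M" "\<And>i. 0 < w $ i" "w v* M = l *\<^sub>R w"
    and "map_matrix complex_of_real M *v z = \<zeta> *s z" "z \<noteq> 0" "\<zeta> \<noteq> complex_of_real l"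
  shows "Re \<zeta> < l"
proof -
  obtain s where s: "\<And>i j. 0 \<le> (mat s + M) $ i $ j"
    using metzler_nonneg_shift[OF assms(1)] by metis
  have le: "cmod (complex_of_real s + \<zeta>) \<le> s + l"
    by (rule complex_eigenvalue_le[OF s assms(2-5)])
  have "Re \<zeta> \<le> l" using le complex_Re_le_cmod[of "complex_of_real s + \<zeta>"] by simp
  moreover have "Re \<zeta> \<noteq> l"
  proof
    assume "Re \<zeta> = l"
    then have "(s + l)\<^sup>2 + (Im \<zeta>)\<^sup>2 \<le> (s + l)\<^sup>2"
      using power_mono[OF le, of 2] by (simp add: cmod_power2)
    then have "Im \<zeta> = 0" by simp
    with \<open>Re \<zeta> = l\<close> assms(6) show False by (simp add: complex_eq_iff)
  qed
  ultimately show ?thesis by simp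
qed

text \<open>For the eigenvalue \<open>l\<close> the row inequalities say that \<open>M *v y\<close>
  dominates \<open>l\<close> times the modulus vector \<open>y\<close>, while the weighted
  differences sum to zero. So \<open>y\<close> is itself a nonnegative eigenvector, and
  irreducibility makes it strictly positive.\<close>

lemma perron_complex_eigenvector_nonzero:
  fixes z :: "complex^'n"
  assumes "metzler M" "no_zero_block M" and w: "\<And>i. 0 < w $ i" "w v* M = l *\<^sub>R w"
    and eig: "map_matrix complex_of_real M *v z = complex_of_real l *s z" and "z \<noteq> 0"
  shows "z $ k \<noteq> 0"
proof -
  obtain s where s: "\<And>i j. 0 \<le> (mat s + M) $ i $ j"
    using metzler_nonneg_shift[OF assms(1)] by metis
  define y where "y = (\<chi> j. cmod (z $ j))"
  \<comment> \<open>The sign is needed to read the modulus of \<open>s + l\<close> as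
    \<open>s + l\<close> itself.\<close>
  have "0 \<le> s + l"
    using complex_eigenvalue_le[OF s w eig \<open>z \<noteq> 0\<close>] norm_ge_zero order_trans by blast
  then have "cmod (complex_of_real s + complex_of_real l) = s + l"
    by (metis norm_of_real of_real_add abs_of_nonneg)
  then have le: "l * y $ i \<le> (M *v y) $ i" for i
    using complex_eigenvector_norm_le[OF s eig, of i]
    by (simp add: y_def algebra_simps)
  have "(\<Sum>i\<in>UNIV. w $ i * ((M *v y) $ i - l * y $ i)) = 0"
    using left_eigenvector_sum[OF w(2), of y]
    by (simp add: right_diff_distrib sum_subtractf sum_distrib_left mult_ac)
  then have "w $ i * ((M *v y) $ i - l * y $ i) = 0" for i
    using le w(1) sum_nonneg_eq_0_iff[of UNIV "\<lambda>i. w $ i * ((M *v y) $ i - l * y $ i)"]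
    by (simp add: less_imp_le)
  then have "(M *v y) $ i = l * y $ i" for i
    using w(1)[of i] by (metis eq_iff_diff_eq_0 less_irrefl mult_eq_0_iff)
  then have "M *v y = l *\<^sub>R y" by (simp add: vec_eq_iff)
  moreover have "y \<noteq> 0" using \<open>z \<noteq> 0\<close> by (auto simp: y_def vec_eq_iff)
  ultimately have "0 < y $ k"
    by (intro nonneg_eigenvector_pos[OF assms(1,2)]) (auto simp: y_def)
  then show ?thesis by (simp add: y_def)
qed

section \<open>Simplicity of the Perron eigenvalue\<close>

text \<open>Evaluation is a ring homomorphism and so commutes with the Leibniz expansion.\<close>

lemma poly_det: "poly (det M) x = det (map_matrix (\<lambda>p. poly p x) M)"
  for M :: "'a::comm_ring_1 poly^'n^'n"
  by (simp add: det_def poly_sum poly_prod)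

lemma det_column_scale:
  "det (\<chi> i j. if j = k then c * v $ i else M $ i $ j)
     = c * det (\<chi> i j. if j = k then v $ i else M $ i $ j)"
  for M :: "'a::comm_ring_1^'n^'n"
proof -
  have tr: "det (\<chi> i j. if j = k then u $ i else M $ i $ j)
      = det (\<chi> i. if i = k then u else (\<chi> j. M $ j $ i))" for u :: "'a^'n"
    by (subst det_transpose[symmetric]) (simp add: transpose_def vec_eq_iff if_distrib cong: if_cong,
       rule arg_cong[of _ _ det], simp add: vec_eq_iff)
  show ?thesis
    using tr[of "c *s v"] tr[of v] det_row_mul[of k c "\<lambda>_. v" "\<lambda>i. \<chi> j. M $ j $ i"]
    by (simp cong: if_cong)
qed

text \<open>Replacing column \<open>k\<close> of \<open>x I - C\<close> by \<open>(x I - C) v = (x - l) v\<close> multiplies the determinant by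
  \<open>v $ k\<close>, which exhibits the factor \<open>x - l\<close>.\<close>
lemma charpoly_deflate:
  fixes C :: "complex^'n^'n"
  assumes "C *v v = l *s v" "v $ k \<noteq> 0"
  shows "smult (v $ k) (mat_charpoly C) = [:-l, 1:] *
     det (\<chi> i j. if j = k then [:v $ i:] else (mat [:0, 1:] - map_matrix (\<lambda>a. [:a:]) C) $ i $ j)"
    (is "_ = _ * ?q")
proof -
  \<comment> \<open>A complex polynomial is determined by its values, so the identity is checked at
    each \<open>x\<close>, where the entries lie in a field and \<open>cramer_lemma\<close>
    applies.\<close>
  have "poly (smult (v $ k) (mat_charpoly C)) x = poly ([:-l, 1:] * ?q) x" for x
  proof -
    have M: "map_matrix (\<lambda>p. poly p x) (mat [:0, 1:] - map_matrix (\<lambda>a. [:a:]) C) = mat x - C"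
      by (simp add: vec_eq_iff mat_def)
    have Mv: "(mat x - C) *v v = (x - l) *s v"
      using assms(1)
      by (simp add: vec_eq_iff left_diff_distrib mat_def sum_subtractf
          matrix_vector_mult_def if_distrib[of "\<lambda>a. a * _"] cong: if_cong)
    have "v $ k * det (mat x - C)
        = det (\<chi> i j. if j = k then (x - l) * v $ i else (mat x - C) $ i $ j)"
      unfolding cramer_lemma[of k "mat x - C" v, symmetric] Mv vector_smult_component ..
    also have "\<dots> = (x - l) * det (\<chi> i j. if j = k then v $ i else (mat x - C) $ i $ j)"
      by (rule det_column_scale)
    also have "(\<chi> i j. if j = k then v $ i else (mat x - C) $ i $ j)
       = map_matrix (\<lambda>p. poly p x) (\<chi> i j. if j = k then [:v $ i:]
            else (mat [:0, 1:] - map_matrix (\<lambda>a. [:a:]) C) $ i $ j)"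
      by (simp add: vec_eq_iff mat_def)
    finally show ?thesis
      by (simp add: mat_charpoly_def poly_det M left_diff_distrib)
  qed
  then show ?thesis by (simp add: poly_eq_poly_eq_iff[symmetric] fun_eq_iff)
qed

text \<open>After \<open>charpoly_deflate\<close> removes one factor, it remains to see that the
  cofactor \<open>det Q\<close> does not vanish at \<open>l\<close>. Its value there is
  \<open>det N\<close>, and \<open>N\<close> is shown to have trivial kernel.\<close>

lemma alg_multiplicity_perron:
  fixes M :: "real^'n^'n"
  assumes "metzler M" "no_zero_block M"
    and v: "\<And>i. 0 < v $ i" "M *v v = l *\<^sub>R v" and w: "\<And>i. 0 < w $ i" "w v* M = l *\<^sub>R w"
  shows "alg_multiplicity (map_matrix complex_of_real M) (complex_of_real l) = 1"
proof -
  \<comment> \<open>The replaced column is arbitrary because no entry of \<open>v\<close>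
    vanishes.\<close>
  fix k :: 'n
  define C where "C = map_matrix complex_of_real M"
  define vc where "vc = (\<chi> i. complex_of_real (v $ i))"
  define L where "L = complex_of_real l"
  define Q where "Q = (\<chi> i j. if j = k then [:vc $ i:]
      else (mat [:0, 1:] - map_matrix (\<lambda>a. [:a:]) C) $ i $ j)"
  define N where "N = (\<chi> i j. if j = k then vc $ i else (mat L - C) $ i $ j)"
  have Cvc: "C *v vc = L *s vc"
    using v(2) by (simp add: C_def vc_def L_def vec_eq_iff matrix_vector_mult_def
        flip: of_real_mult of_real_sum)
  have vck: "vc $ k \<noteq> 0" using v(1)[of k] by (simp add: vc_def)
  have eq: "smult (vc $ k) (mat_charpoly C) = [:-L, 1:] * det Q"
    unfolding Q_def by (rule charpoly_deflate[OF Cvc vck])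
  have "z = 0" if "N *v z = 0" for z
  proof -
    \<comment> \<open>Clearing coordinate \<open>k\<close> separates the replaced column:
      \<open>N *v z\<close> is \<open>(mat L - C) *v y\<close> plus \<open>z $ k\<close> times
      \<open>vc\<close>.\<close>
    define y where "y = (\<chi> j. if j = k then 0 else z $ j)"
    have row: "L * y $ i - (C *v y) $ i + z $ k * vc $ i = 0" for i
    proof -
      have "0 = (\<Sum>j\<in>UNIV. N $ i $ j * z $ j)"
        using arg_cong[OF that, of "\<lambda>u. u $ i"] by (simp add: matrix_vector_mult_def)
      also have "\<dots> = (\<Sum>j\<in>UNIV. (mat L - C) $ i $ j * y $ j + (if j = k then vc $ i * z $ k else 0))"
        by (rule sum.cong) (auto simp: N_def y_def)
      also have "\<dots> = L * y $ i - (C *v y) $ i + z $ k * vc $ i"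
        by (simp add: sum.distrib sum_subtractf left_diff_distrib mat_def matrix_vector_mult_def
            if_distrib[of "\<lambda>a. a * _"] cong: if_cong)
      finally show ?thesis by simp
    qed
    have wC: "(\<Sum>i\<in>UNIV. of_real (w $ i) * (C *v y) $ i) = L * (\<Sum>i\<in>UNIV. of_real (w $ i) * y $ i)"
    proof -
      have col: "(\<Sum>i\<in>UNIV. of_real (w $ i) * C $ i $ j) = L * of_real (w $ j)" for j
        using arg_cong[OF w(2), of "\<lambda>u. complex_of_real (u $ j)"]
        by (simp add: C_def L_def vector_matrix_mult_def mult.commute)
      have "(\<Sum>i\<in>UNIV. of_real (w $ i) * (C *v y) $ i)
          = (\<Sum>i\<in>UNIV. \<Sum>j\<in>UNIV. of_real (w $ i) * C $ i $ j * y $ j)"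
        by (simp add: matrix_vector_mult_def sum_distrib_left mult.assoc)
      also have "\<dots> = (\<Sum>j\<in>UNIV. (\<Sum>i\<in>UNIV. of_real (w $ i) * C $ i $ j) * y $ j)"
        by (subst sum.swap) (simp add: sum_distrib_right)
      also have "\<dots> = L * (\<Sum>i\<in>UNIV. of_real (w $ i) * y $ i)"
        by (simp add: col sum_distrib_left mult.assoc)
      finally show ?thesis .
    qed
    \<comment> \<open>Pairing with the left eigenvector annihilates the range of
      \<open>mat L - C\<close>, so only the term with \<open>z $ k\<close> remains.\<close>
    have "0 = (\<Sum>i\<in>UNIV. of_real (w $ i) * (L * y $ i - (C *v y) $ i + z $ k * vc $ i))"
      by (simp only: row) simp
    also have "\<dots> = (L * (\<Sum>i\<in>UNIV. of_real (w $ i) * y $ i) - (\<Sum>i\<in>UNIV. of_real (w $ i) * (C *v y) $ i))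
        + z $ k * (\<Sum>i\<in>UNIV. of_real (w $ i) * vc $ i)"
      by (simp add: sum_distrib_left sum_subtractf sum.distrib algebra_simps)
    also have "\<dots> = z $ k * of_real (\<Sum>i\<in>UNIV. w $ i * v $ i)"
      by (simp add: wC vc_def)
    finally have "z $ k * of_real (\<Sum>i\<in>UNIV. w $ i * v $ i) = 0" by simp
    moreover have "(\<Sum>i\<in>UNIV. w $ i * v $ i) > 0" by (rule sum_pos) (auto simp: v w)
    ultimately have zk: "z $ k = 0" by (metis less_irrefl mult_eq_0_iff of_real_eq_0_iff)
    then have yz: "y = z" by (auto simp: y_def vec_eq_iff)
    have "C *v z = L *s z" using row zk unfolding yz by (simp add: vec_eq_iff)
    \<comment> \<open>A nonzero \<open>z\<close> would be an eigenvector for \<open>l\<close> with a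
      vanishing coordinate.\<close>
    then show "z = 0"
      using perron_complex_eigenvector_nonzero[OF assms(1,2) w, of z k] zk
      by (auto simp: C_def L_def)
  qed
  then have "invertible N"
    by (simp add: invertible_left_inverse matrix_left_invertible_ker)
  then have "det N \<noteq> 0" by (simp add: invertible_det_nz)
  moreover have "map_matrix (\<lambda>p. poly p L) Q = N"
    by (simp add: vec_eq_iff Q_def N_def mat_def)
  ultimately have "poly (det Q) L \<noteq> 0" by (simp add: poly_det)
  then have q: "order L (det Q) = 0" "det Q \<noteq> 0" by (auto simp: order_root)
  have "order L (mat_charpoly C) = order L (smult (vc $ k) (mat_charpoly C))"
    using vck by (simp add: order_smult)
  also have "\<dots> = order L [:-L, 1:] + order L (det Q)"
    unfolding eq by (rule order_mult) (use q(2) in \<open>simp only: mult_eq_0_iff pCons_eq_0_iff, simp\<close>)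
  also have "\<dots> = 1" using q(1) order_power_n_n[of L 1] by simp
  finally show ?thesis by (simp add: alg_multiplicity_def C_def L_def)
qed

text \<open>The common eigenvalue of the Perron vectors meets all defining conditions, so by
  uniqueness it is the value of the description. The dynamics needs only this positive right
  eigenvector.\<close>

lemma frobenius_eigenvalue_vector:
  fixes M :: "real^'n^'n"
  assumes "metzler M" "irreducible_matrix M"
  obtains v where "\<And>i. 0 < v $ i" "M *v v = frobenius_eigenvalue M *\<^sub>R v"
proof -
  have nzb: "no_zero_block M" by (rule irreducible_no_zero_block[OF assms(2)])
  obtain v w l where v: "\<And>i. 0 < v $ i" "M *v v = l *\<^sub>R v" and w: "\<And>i. 0 < w $ i" "w v* M = l *\<^sub>R w"
    using perron_vectors[OF assms(1) nzb] by metis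
  have "mat_eigenvalue (map_matrix complex_of_real M) (complex_of_real l)"
    unfolding mat_eigenvalue_def
  proof (intro exI conjI)
    show "(\<chi> i. complex_of_real (v $ i)) \<noteq> 0" using v(1) by (simp add: vec_eq_iff less_imp_neq[symmetric])
    show "map_matrix complex_of_real M *v (\<chi> i. complex_of_real (v $ i)) = complex_of_real l *s (\<chi> i. complex_of_real (v $ i))"
      using v(2) by (simp add: vec_eq_iff matrix_vector_mult_def flip: of_real_mult of_real_sum)
  qed
  moreover have "Re z < l"
    if "mat_eigenvalue (map_matrix complex_of_real M) z" "z \<noteq> complex_of_real l" for z
    using that complex_eigenvalue_Re_less[OF assms(1) w] by (auto simp: mat_eigenvalue_def)
  ultimately have "is_frobenius_eigenvalue M l"
    using alg_multiplicity_perron[OF assms(1) nzb v w] by (simp add: is_frobenius_eigenvalue_def Let_def)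
  then have "frobenius_eigenvalue M = l"
    unfolding frobenius_eigenvalue_def
    by (rule the_equality) (rule is_frobenius_eigenvalue_unique[OF _ \<open>is_frobenius_eigenvalue M l\<close>])
  with v show thesis by (intro that[of v]) auto
qed

section \<open>Linear differential equations\<close>

lemma has_vector_derivative_cart:
  fixes f :: "real \<Rightarrow> real^'n"
  assumes "\<And>i. ((\<lambda>t. f t $ i) has_real_derivative f' $ i) (at x within S)"
  shows "(f has_vector_derivative f') (at x within S)"
  unfolding has_vector_derivative_def
proof (subst has_derivative_componentwise_within, rule ballI)
  fix b :: "real^'n"
  assume "b \<in> Basis"
  then obtain i where b: "b = axis i 1" by (auto simp: Basis_vec_def)
  have "((\<lambda>t. f t $ i) has_derivative (\<lambda>t. t * f' $ i)) (at x within S)"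
    using assms[of i] by (simp add: has_field_derivative_def mult_commute_abs)
  then show "((\<lambda>t. f t \<bullet> b) has_derivative (\<lambda>t. (t *\<^sub>R f') \<bullet> b)) (at x within S)"
    by (simp add: b inner_axis)
qed

text \<open>A Gronwall argument: with \<open>K\<close> bounding the operator norm of
  \<open>M\<close>, the squared norm of a solution grows at rate at most \<open>2 * K\<close>, which
  the exponential weight compensates.\<close>

lemma lin_ode_solution_zero:
  fixes M :: "real^'n^'n"
  assumes "lin_ode_solution M 0 \<phi>" and "0 \<le> t"
  shows "\<phi> t = 0"
proof (cases "t = 0")
  case True with assms show ?thesis by (simp add: lin_ode_solution_def)
next
  case False
  with \<open>0 \<le> t\<close> have "0 < t" by simp
  obtain K where K: "\<And>x. norm (M *v x) \<le> norm x * K"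
    using bounded_linear.bounded[OF matrix_vector_mul_bounded_linear[of M]] by auto
  have deriv: "(\<phi> has_vector_derivative M *v \<phi> s) (at s within {0..})" if "0 \<le> s" for s
    using assms(1) that by (simp add: lin_ode_solution_def)
  \<comment> \<open>an energy that cannot increase and vanishes at time 0\<close>
  define E where "E = (\<lambda>s. exp (- (2 * K * s)) * (\<phi> s \<bullet> \<phi> s))"
  have E': "(E has_real_derivative exp (- (2 * K * s)) * (2 * (\<phi> s \<bullet> (M *v \<phi> s)) - 2 * K * (\<phi> s \<bullet> \<phi> s)))
      (at s within {0..})" if "0 \<le> s" for s
  proof -
    have "((\<lambda>s. \<phi> s \<bullet> \<phi> s) has_derivative (\<lambda>h. \<phi> s \<bullet> (h *\<^sub>R (M *v \<phi> s)) + (h *\<^sub>R (M *v \<phi> s)) \<bullet> \<phi> s))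
        (at s within {0..})"
      using deriv[OF that] unfolding has_vector_derivative_def by (intro has_derivative_inner)
    moreover have "(\<lambda>h. \<phi> s \<bullet> (h *\<^sub>R (M *v \<phi> s)) + (h *\<^sub>R (M *v \<phi> s)) \<bullet> \<phi> s)
        = (*) (2 * (\<phi> s \<bullet> (M *v \<phi> s)))"
      by (auto simp: fun_eq_iff inner_commute)
    ultimately have "((\<lambda>s. \<phi> s \<bullet> \<phi> s) has_real_derivative 2 * (\<phi> s \<bullet> (M *v \<phi> s))) (at s within {0..})"
      by (simp add: has_field_derivative_def)
    then show ?thesis unfolding E_def
      by (auto intro!: derivative_eq_intros simp: algebra_simps)
  qed
  have neg: "exp (- (2 * K * s)) * (2 * (\<phi> s \<bullet> (M *v \<phi> s)) - 2 * K * (\<phi> s \<bullet> \<phi> s)) \<le> 0" for s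
  proof -
    have "\<phi> s \<bullet> (M *v \<phi> s) \<le> norm (\<phi> s) * norm (M *v \<phi> s)" by (rule norm_cauchy_schwarz)
    also have "\<dots> \<le> norm (\<phi> s) * (norm (\<phi> s) * K)" by (intro mult_left_mono K) simp
    also have "\<dots> = K * (\<phi> s \<bullet> \<phi> s)" by (simp add: dot_square_norm power2_eq_square)
    finally show ?thesis by (simp add: mult_nonneg_nonpos)
  qed
  have "E t \<le> E 0"
  proof (rule DERIV_nonpos_imp_decreasing_open[of 0 t E])
    show "0 \<le> t" by fact
    show "\<exists>y. (E has_real_derivative y) (at s) \<and> y \<le> 0" if "0 < s" "s < t" for s
    proof -
      \<comment> \<open>One-sided derivatives become two-sided in the interior; at time 0 continuity
        suffices.\<close>
      have "at s within {0..} = at s"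
        using that by (intro at_within_interior) simp
      with E'[of s] neg[of s] that show ?thesis by auto
    qed
    have "continuous_on {0..} E"
      using E' by (intro DERIV_continuous_on) auto
    then show "continuous_on {0..t} E" by (rule continuous_on_subset) auto
  qed
  moreover have "E 0 = 0" using assms(1) by (simp add: E_def lin_ode_solution_def)
  ultimately have "\<phi> t \<bullet> \<phi> t \<le> 0" by (simp add: E_def mult_le_0_iff)
  then show ?thesis by (metis inner_eq_zero_iff inner_ge_zero order_antisym)
qed

lemma lin_ode_solution_lincomb:
  fixes M :: "real^'n^'n"
  assumes "lin_ode_solution M x \<phi>" "lin_ode_solution M y \<psi>"
  shows "lin_ode_solution M (a *\<^sub>R x + b *\<^sub>R y) (\<lambda>t. a *\<^sub>R \<phi> t + b *\<^sub>R \<psi> t)"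
  unfolding lin_ode_solution_def
proof (intro conjI allI impI)
  show "a *\<^sub>R \<phi> 0 + b *\<^sub>R \<psi> 0 = a *\<^sub>R x + b *\<^sub>R y"
    using assms by (simp add: lin_ode_solution_def)
  fix t :: real assume "0 \<le> t"
  then have "((\<lambda>t. a *\<^sub>R \<phi> t + b *\<^sub>R \<psi> t) has_vector_derivative
      a *\<^sub>R (M *v \<phi> t) + b *\<^sub>R (M *v \<psi> t)) (at t within {0..})"
    using assms unfolding lin_ode_solution_def
    by (intro has_vector_derivative_add bounded_linear.has_vector_derivative[OF bounded_linear_scaleR_right]) auto
  then show "((\<lambda>t. a *\<^sub>R \<phi> t + b *\<^sub>R \<psi> t) has_vector_derivative
      M *v (a *\<^sub>R \<phi> t + b *\<^sub>R \<psi> t)) (at t within {0..})"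
    by (simp add: matrix_vector_right_distrib matrix_vector_mult_scaleR)
qed

lemma lin_ode_solution_unique:
  fixes M :: "real^'n^'n"
  assumes "lin_ode_solution M x \<phi>" "lin_ode_solution M x \<psi>" "0 \<le> t"
  shows "\<phi> t = \<psi> t"
  using lin_ode_solution_zero[of M "\<lambda>t. 1 *\<^sub>R \<phi> t + (-1) *\<^sub>R \<psi> t" t]
    lin_ode_solution_lincomb[OF assms(1,2), of 1 "-1"] assms(3) by simp

text \<open>This discharges the description in \<open>state\<close>: any solution provides
  existence, and values of solutions at \<open>t\<close> are unique.\<close>

lemma state_eq:
  assumes "lin_ode_solution (A u) x0 \<phi>" "0 \<le> t"
  shows "state A t u x0 = \<phi> t"
  unfolding state_def
proof (rule the_equality)
  show "\<exists>\<psi>. lin_ode_solution (A u) x0 \<psi> \<and> \<phi> t = \<psi> t" using assms(1) by blast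
  show "z = \<phi> t" if "\<exists>\<psi>. lin_ode_solution (A u) x0 \<psi> \<and> z = \<psi> t" for z
    using that lin_ode_solution_unique[OF _ assms(1) assms(2)] by blast
qed

lemma lin_ode_solution_exp_eigenvector:
  fixes M :: "real^'n^'n"
  assumes "M *v v = l *\<^sub>R v"
  shows "lin_ode_solution M v (\<lambda>t. exp (l * t) *\<^sub>R v)"
proof -
  have "((\<lambda>t. exp (l * t) *\<^sub>R v) has_vector_derivative M *v (exp (l * t) *\<^sub>R v)) (at t within {0..})" for t
  proof -
    have "((\<lambda>t. exp (l * t)) has_real_derivative l * exp (l * t)) (at t within {0..})"
      by (auto intro!: derivative_eq_intros)
    from has_vector_derivative_scaleR[OF this has_vector_derivative_const[of v]]
    show ?thesis by (simp add: assms matrix_vector_mult_scaleR mult.commute)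
  qed
  then show ?thesis by (simp add: lin_ode_solution_def)
qed

text \<open>The terms are dominated by \<open>norm x\<close> times the exponential series of
  \<open>K * \<bar>t\<bar>\<close>, where \<open>K\<close> bounds the operator norm.\<close>

lemma summable_matrix_exp_series:
  fixes B :: "real^'n^'n"
  shows "summable (\<lambda>k. (((*v) B) ^^ k) x $ i / fact k * t ^ k)"
proof -
  define X where "X = (\<lambda>k. (((*v) B) ^^ k) x)"
  obtain K where K: "K > 0" "\<And>x. norm (B *v x) \<le> norm x * K"
    using bounded_linear.pos_bounded[OF matrix_vector_mul_bounded_linear[of B]] by auto
  have norm_X: "norm (X k) \<le> norm x * K ^ k" for k
  proof (induction k)
    case (Suc k)
    have "norm (X (Suc k)) \<le> norm (X k) * K" by (simp add: X_def K(2))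
    also have "\<dots> \<le> norm x * K ^ k * K" using Suc K(1) by (intro mult_right_mono) auto
    finally show ?case by (simp add: mult_ac)
  qed (simp add: X_def)
  have "summable (\<lambda>k. X k $ i / fact k * t ^ k)"
  proof (rule summable_comparison_test)
    show "\<exists>N. \<forall>n\<ge>N. norm (X n $ i / fact n * t ^ n) \<le> norm x * (inverse (fact n) * (K * \<bar>t\<bar>) ^ n)"
    proof (intro exI allI impI)
      fix n
      have "\<bar>X n $ i\<bar> \<le> norm x * K ^ n" using component_le_norm_cart norm_X order_trans by blast
      then have "\<bar>X n $ i\<bar> * (\<bar>t\<bar> ^ n * inverse (fact n))
          \<le> norm x * K ^ n * (\<bar>t\<bar> ^ n * inverse (fact n))"
        by (rule mult_right_mono) simp
      then show "norm (X n $ i / fact n * t ^ n) \<le> norm x * (inverse (fact n) * (K * \<bar>t\<bar>) ^ n)"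
        by (simp add: abs_mult power_abs power_mult_distrib field_simps)
    qed
    show "summable (\<lambda>n. norm x * (inverse (fact n) * (K * \<bar>t\<bar>) ^ n))"
      by (intro summable_mult summable_exp)
  qed
  then show ?thesis by (simp only: X_def)
qed

text \<open>The formula is the matrix exponential of \<open>t\<close> times \<open>B\<close> applied
  to \<open>x0\<close>, read coordinatewise as power series. Termwise differentiation cancels one
  factor of the factorial and leaves the next iterate, which is \<open>B\<close> applied to the
  current one.\<close>

lemma lin_ode_solution_series:
  fixes B :: "real^'n^'n"
  shows "lin_ode_solution B x0 (\<lambda>t. \<chi> i. \<Sum>k. (((*v) B) ^^ k) x0 $ i / fact k * t ^ k)"
proof -
  define X where "X = (\<lambda>k. (((*v) B) ^^ k) x0)"
  define c where "c = (\<lambda>i k. X k $ i / fact k)"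
  have summ: "summable (\<lambda>k. c i k * t ^ k)" for i t
    unfolding c_def X_def by (rule summable_matrix_exp_series)
  have diffs: "diffs (c i) k = (\<Sum>j\<in>UNIV. B $ i $ j * c j k)" for i k
  proof -
    have "diffs (c i) k = X (Suc k) $ i / fact k"
      by (simp add: diffs_def c_def field_simps del: of_nat_Suc)
    also have "X (Suc k) $ i = (\<Sum>j\<in>UNIV. B $ i $ j * X k $ j)"
      by (simp add: X_def matrix_vector_mult_def)
    finally show ?thesis by (simp add: c_def sum_divide_distrib)
  qed
  have "((\<lambda>t. \<Sum>k. c i k * t ^ k) has_real_derivative
      (\<Sum>j\<in>UNIV. B $ i $ j * (\<Sum>k. c j k * t ^ k))) (at t)" for i t
  proof -
    have "(\<Sum>k. diffs (c i) k * t ^ k) = (\<Sum>k. \<Sum>j\<in>UNIV. B $ i $ j * (c j k * t ^ k))"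
      by (simp add: diffs sum_distrib_right mult.assoc)
    also have "\<dots> = (\<Sum>j\<in>UNIV. B $ i $ j * (\<Sum>k. c j k * t ^ k))"
      using summ by (subst suminf_sum) (auto intro!: sum.cong suminf_mult summable_mult)
    finally show ?thesis
      using termdiffs_strong_converges_everywhere[of "c i" t] summ by simp
  qed
  then have "((\<lambda>t. \<chi> i. \<Sum>k. c i k * t ^ k) has_vector_derivative
      B *v (\<chi> i. \<Sum>k. c i k * t ^ k)) (at t within S)" for t S
    by (intro has_vector_derivative_cart) (simp add: matrix_vector_mult_def has_field_derivative_at_within)
  \<comment> \<open>Only the term of index 0 survives, as \<open>0 ^ 0 = 1\<close>.\<close>
  moreover have "(\<chi> i. \<Sum>k. c i k * 0 ^ k) = x0"
    by (simp only: powser_zero) (simp add: c_def X_def vec_eq_iff)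
  ultimately show ?thesis by (simp add: lin_ode_solution_def c_def X_def)
qed

lemma lin_ode_solution_shift:
  fixes M :: "real^'n^'n"
  assumes "lin_ode_solution (mat s + M) x \<phi>"
  shows "lin_ode_solution M x (\<lambda>t. exp (- (s * t)) *\<^sub>R \<phi> t)"
proof -
  have "((\<lambda>t. exp (- (s * t)) *\<^sub>R \<phi> t) has_vector_derivative M *v (exp (- (s * t)) *\<^sub>R \<phi> t))
      (at t within {0..})" if "0 \<le> t" for t
  proof -
    have "(\<phi> has_vector_derivative s *\<^sub>R \<phi> t + M *v \<phi> t) (at t within {0..})"
      using assms that by (simp add: lin_ode_solution_def mat_shift_mult)
    moreover have "((\<lambda>t. exp (- (s * t))) has_real_derivative - s * exp (- (s * t))) (at t within {0..})"
      by (auto intro!: derivative_eq_intros)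
    ultimately have "((\<lambda>t. exp (- (s * t)) *\<^sub>R \<phi> t) has_vector_derivative
        exp (- (s * t)) *\<^sub>R (s *\<^sub>R \<phi> t + M *v \<phi> t) + (- s * exp (- (s * t))) *\<^sub>R \<phi> t) (at t within {0..})"
      by (intro has_vector_derivative_scaleR)
    then show ?thesis by (simp add: algebra_simps matrix_vector_mult_scaleR)
  qed
  with assms show ?thesis by (simp add: lin_ode_solution_def)
qed

section \<open>Positivity and order preservation of the flow\<close>

text \<open>For the nonnegative matrix \<open>mat s + M\<close> every coefficient of the exponential
  series is nonnegative. Undoing the shift multiplies by a positive scalar, so signs
  persist.\<close>

lemma metzler_solution_nonneg:
  fixes M :: "real^'n^'n"
  assumes "metzler M" "\<And>i. 0 \<le> x $ i"
  obtains \<phi> where "lin_ode_solution M x \<phi>" "\<And>t i. 0 \<le> t \<Longrightarrow> 0 \<le> \<phi> t $ i"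
proof -
  obtain s where s: "\<And>i j. 0 \<le> (mat s + M) $ i $ j"
    using metzler_nonneg_shift[OF assms(1)] by metis
  define X where "X = (\<lambda>k. (((*v) (mat s + M)) ^^ k) x)"
  have X: "0 \<le> X k $ i" for k i
  proof (induction k arbitrary: i)
    case (Suc k)
    then have "0 \<le> (\<Sum>j\<in>UNIV. (mat s + M) $ i $ j * X k $ j)"
      by (intro sum_nonneg mult_nonneg_nonneg s)
    then show ?case by (simp add: X_def matrix_vector_mult_def)
  qed (simp add: X_def assms(2))
  define \<phi> where "\<phi> = (\<lambda>t. \<chi> i. \<Sum>k. X k $ i / fact k * t ^ k)"
  have "lin_ode_solution M x (\<lambda>t. exp (- (s * t)) *\<^sub>R \<phi> t)"
    unfolding \<phi>_def X_def by (intro lin_ode_solution_shift lin_ode_solution_series)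
  moreover have "0 \<le> \<phi> t $ i" if "0 \<le> t" for t i
  proof -
    have "0 \<le> (\<Sum>k. X k $ i / fact k * t ^ k)"
      using X that unfolding X_def by (intro suminf_nonneg summable_matrix_exp_series) simp
    then show ?thesis by (simp add: \<phi>_def)
  qed
  ultimately show thesis by (intro that) auto
qed

text \<open>By linearity, order preservation reduces to positivity: the differences
  \<open>x - a *\<^sub>R v\<close> and \<open>b *\<^sub>R v - x\<close> start nonnegative and stay
  so, while \<open>v\<close> evolves by the scalar \<open>exp (l * t)\<close>.\<close>

lemma state_eigenvector_bounds:
  fixes A :: "'u \<Rightarrow> real^'n^'n"
  assumes "metzler (A u)" and v: "A u *v v = l *\<^sub>R v" and "0 \<le> t"
    and x: "\<And>i. 0 < x $ i"
  shows "(\<And>i. a * v $ i \<le> x $ i) \<Longrightarrow> a * exp (l * t) * v $ i \<le> state A t u x $ i"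
    and "(\<And>i. x $ i \<le> b * v $ i) \<Longrightarrow> state A t u x $ i \<le> b * exp (l * t) * v $ i"
proof -
  note exp_sol = lin_ode_solution_exp_eigenvector[OF v]
  obtain \<phi> where \<phi>: "lin_ode_solution (A u) x \<phi>"
    using metzler_solution_nonneg[OF assms(1), of x] x by (metis less_imp_le)
  have st: "state A t u x = \<phi> t" by (rule state_eq[of A u x \<phi> t, OF \<phi> \<open>0 \<le> t\<close>])
  {
    assume "\<And>i. a * v $ i \<le> x $ i"
    \<comment> \<open>The difference is written in the shape of
      \<open>lin_ode_solution_lincomb\<close>, so that uniqueness can identify \<open>\<psi>\<close>
      with the combination of the known solutions.\<close>
    then have "0 \<le> (1 *\<^sub>R x + (- a) *\<^sub>R v) $ i" for i by simp
    then obtain \<psi> where "lin_ode_solution (A u) (1 *\<^sub>R x + (- a) *\<^sub>R v) \<psi>" "\<And>t i. 0 \<le> t \<Longrightarrow> 0 \<le> \<psi> t $ i"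
      using metzler_solution_nonneg[OF assms(1), of "1 *\<^sub>R x + (- a) *\<^sub>R v"] by blast
    note \<psi> = this(1) this(2)[OF \<open>0 \<le> t\<close>, of i]
    show "a * exp (l * t) * v $ i \<le> state A t u x $ i"
      using lin_ode_solution_unique[OF \<psi>(1) lin_ode_solution_lincomb[OF \<phi> exp_sol] \<open>0 \<le> t\<close>] \<psi>(2)
      by (simp add: st)
  }
  {
    assume "\<And>i. x $ i \<le> b * v $ i"
    then have "0 \<le> ((-1) *\<^sub>R x + b *\<^sub>R v) $ i" for i by simp
    then obtain \<psi> where "lin_ode_solution (A u) ((-1) *\<^sub>R x + b *\<^sub>R v) \<psi>" "\<And>t i. 0 \<le> t \<Longrightarrow> 0 \<le> \<psi> t $ i"
      using metzler_solution_nonneg[OF assms(1), of "(-1) *\<^sub>R x + b *\<^sub>R v"] by blast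
    note \<psi> = this(1) this(2)[OF \<open>0 \<le> t\<close>, of i]
    show "state A t u x $ i \<le> b * exp (l * t) * v $ i"
      using lin_ode_solution_unique[OF \<psi>(1) lin_ode_solution_lincomb[OF \<phi> exp_sol] \<open>0 \<le> t\<close>] \<psi>(2)
      by (simp add: st)
  }
qed

section \<open>Comparison constants and the logarithmic rate\<close>

lemma positive_vectors_comparable:
  fixes v x :: "real^'n"
  assumes "\<And>i. 0 < v $ i" "\<And>i. 0 < x $ i"
  obtains a b where "0 < a" "0 < b" "\<And>i. a * v $ i \<le> x $ i" "\<And>i. x $ i \<le> b * v $ i"
proof
  \<comment> \<open>The constants are the extreme coordinate ratios, attained because there are
    finitely many indices.\<close>
  define R where "R = range (\<lambda>i. x $ i / v $ i)"
  have R: "finite R" "R \<noteq> {}" by (auto simp: R_def)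
  have pos: "r > 0" if "r \<in> R" for r using that assms by (auto simp: R_def)
  show "0 < Min R" using R pos by simp
  show "0 < Max R" using R pos by (metis Max_in)
  have "Min R \<le> x $ i / v $ i" "x $ i / v $ i \<le> Max R" for i
    using R by (auto simp: R_def)
  with assms(1) show "Min R * v $ i \<le> x $ i" "x $ i \<le> Max R * v $ i" for i
    by (simp_all add: pos_le_divide_eq pos_divide_le_eq)
qed

text \<open>The constant factors contribute only \<open>ln p / t\<close> and
  \<open>ln q / t\<close>, which tend to zero.\<close>

lemma log_rate_limit:
  fixes y :: "real \<Rightarrow> real"
  assumes "0 < p" and lo: "\<And>t. 0 < t \<Longrightarrow> p * exp (r * t) \<le> y t"
    and hi: "\<And>t. 0 < t \<Longrightarrow> y t \<le> q * exp (r * t)"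
  shows "((\<lambda>t. 1 / t * ln (y t)) \<longlongrightarrow> r) at_top"
proof (rule tendsto_sandwich)
  have bounds: "ln p / t + r \<le> 1 / t * ln (y t) \<and> 1 / t * ln (y t) \<le> ln q / t + r" if "0 < t" for t
  proof -
    have py: "0 < p * exp (r * t)" using \<open>0 < p\<close> by simp
    then have y: "0 < y t" using lo[OF that] by linarith
    then have "0 < q * exp (r * t)" using hi[OF that] by linarith
    \<comment> \<open>The sign of \<open>q\<close> is forced by the two bounds on
      \<open>y t\<close>.\<close>
    then have "0 < q" by (simp add: zero_less_mult_iff)
    have "ln (p * exp (r * t)) \<le> ln (y t)" "ln (y t) \<le> ln (q * exp (r * t))"
      using lo[OF that] hi[OF that] py y by (auto intro!: ln_mono)
    then have "ln p + r * t \<le> ln (y t)" "ln (y t) \<le> ln q + r * t"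
      using \<open>0 < p\<close> \<open>0 < q\<close> by (simp_all add: ln_mult)
    then have "(ln p + r * t) / t \<le> ln (y t) / t" "ln (y t) / t \<le> (ln q + r * t) / t"
      using that by (simp_all add: divide_right_mono)
    with that show ?thesis by (simp add: add_divide_distrib)
  qed
  show "\<forall>\<^sub>F t in at_top. ln p / t + r \<le> 1 / t * ln (y t)"
    using eventually_gt_at_top[of 0] by eventually_elim (use bounds in blast)
  show "\<forall>\<^sub>F t in at_top. 1 / t * ln (y t) \<le> ln q / t + r"
    using eventually_gt_at_top[of 0] by eventually_elim (use bounds in blast)
  have "((\<lambda>t. K / t + r) \<longlongrightarrow> 0 + r) at_top" for K
    by (intro tendsto_add tendsto_const tendsto_divide_0[OF tendsto_const] filterlim_at_top_imp_at_infinity filterlim_ident)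
  then show "((\<lambda>t. ln p / t + r) \<longlongrightarrow> r) at_top" "((\<lambda>t. ln q / t + r) \<longlongrightarrow> r) at_top"
    by simp_all
qed

theorem theorem2:
  fixes U :: "'u::euclidean_space set"
    and A :: "'u \<Rightarrow> real^'n^'n"
    and c x0 :: "real^'n"
    and u\<^sub>1 u\<^sub>2 :: 'u
    and \<alpha> :: real
  assumes "convex U"
    and "\<And>u. u \<in> U \<Longrightarrow> metzler (A u)"
    and "\<And>u. u \<in> U \<Longrightarrow> irreducible_matrix (A u)"
    and "\<And>i. 0 < c $ i"
    and "u\<^sub>1 \<in> U" and "u\<^sub>2 \<in> U"
    and "0 < \<alpha>" and "\<alpha> < 1"
    and "\<And>i. 0 < x0 $ i"
  shows "((\<lambda>t. 1 / t * ln (seq_output A c \<alpha> t u\<^sub>1 u\<^sub>2 x0)) \<longlongrightarrow>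
           \<alpha> * frobenius_eigenvalue (A u\<^sub>1) + (1 - \<alpha>) * frobenius_eigenvalue (A u\<^sub>2)) at_top"
proof -
  define l m where "l = frobenius_eigenvalue (A u\<^sub>1)" and "m = frobenius_eigenvalue (A u\<^sub>2)"
  have metz: "metzler (A u\<^sub>1)" "metzler (A u\<^sub>2)" using assms by auto
  obtain v where v: "\<And>i. 0 < v $ i" "A u\<^sub>1 *v v = l *\<^sub>R v"
    using frobenius_eigenvalue_vector[of "A u\<^sub>1"] assms unfolding l_def by metis
  obtain w where w: "\<And>i. 0 < w $ i" "A u\<^sub>2 *v w = m *\<^sub>R w"
    using frobenius_eigenvalue_vector[of "A u\<^sub>2"] assms unfolding m_def by metis
  obtain a b where ab: "0 < a" "0 < b" "\<And>i. a * v $ i \<le> x0 $ i" "\<And>i. x0 $ i \<le> b * v $ i"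
    using positive_vectors_comparable[OF v(1) assms(9)] by metis
  \<comment> \<open>At the switch the state is bounded by multiples of \<open>v\<close>, but the
    second phase needs multiples of \<open>w\<close>. The conversion costs only factors independent
    of \<open>t\<close>.\<close>
  obtain d e where de: "0 < d" "0 < e" "\<And>i. d * w $ i \<le> v $ i" "\<And>i. v $ i \<le> e * w $ i"
    using positive_vectors_comparable[OF w(1) v(1)] by metis
  define r where "r = \<alpha> * l + (1 - \<alpha>) * m"
  have bounds: "a * d * exp (r * t) * w $ i \<le> seq_state A \<alpha> t u\<^sub>1 u\<^sub>2 x0 $ i"
      "seq_state A \<alpha> t u\<^sub>1 u\<^sub>2 x0 $ i \<le> b * e * exp (r * t) * w $ i" if "0 < t" for t i
  proof -
    define z where "z = state A (\<alpha> * t) u\<^sub>1 x0"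
    define E where "E = exp (l * (\<alpha> * t))"
    have "0 < E" by (simp add: E_def)
    have nn: "0 \<le> \<alpha> * t" "0 \<le> (1 - \<alpha>) * t" using that assms by auto
    have zlo: "a * E * v $ i \<le> z $ i" and zhi: "z $ i \<le> b * E * v $ i" for i
      using state_eigenvector_bounds[of A u\<^sub>1 v l "\<alpha> * t" x0, OF metz(1) v(2) nn(1) assms(9)] ab unfolding z_def E_def by auto
    have "0 < a * E * v $ i" for i using ab(1) \<open>0 < E\<close> v(1) by simp
    \<comment> \<open>The intermediate state is again strictly positive, so the bounds apply to the
      second phase.\<close>
    then have z: "0 < z $ i" for i using zlo less_le_trans by blast
    note bounds2 = state_eigenvector_bounds[of A u\<^sub>2 w m "(1 - \<alpha>) * t" z, OF metz(2) w(2) nn(2) z]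
    have "a * E * d * w $ i \<le> z $ i" for i
    proof -
      have "a * E * (d * w $ i) \<le> a * E * v $ i"
        using ab \<open>0 < E\<close> by (intro mult_left_mono de) simp
      with zlo[of i] show ?thesis by (simp add: mult.assoc)
    qed
    moreover have "z $ i \<le> b * E * e * w $ i" for i
    proof -
      have "b * E * v $ i \<le> b * E * (e * w $ i)"
        using ab \<open>0 < E\<close> by (intro mult_left_mono de) simp
      with zhi[of i] show ?thesis by (simp add: mult.assoc)
    qed
    \<comment> \<open>The growth factors of the two phases multiply to a single exponential, whose
      rate \<open>r\<close> is the claimed limit.\<close>
    moreover have "exp (r * t) = E * exp (m * ((1 - \<alpha>) * t))"
      by (simp add: E_def r_def algebra_simps flip: exp_add)
    ultimately show "a * d * exp (r * t) * w $ i \<le> seq_state A \<alpha> t u\<^sub>1 u\<^sub>2 x0 $ i"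
      "seq_state A \<alpha> t u\<^sub>1 u\<^sub>2 x0 $ i \<le> b * e * exp (r * t) * w $ i"
      using bounds2(1)[of "a * E * d" i] bounds2(2)[of "b * E * e" i]
      unfolding seq_state_def z_def[symmetric] by (auto simp: mult_ac)
  qed
  have "0 < c \<bullet> w"
    unfolding inner_vec_def by (rule sum_pos) (auto simp: assms w)
  have "((\<lambda>t. 1 / t * ln (seq_output A c \<alpha> t u\<^sub>1 u\<^sub>2 x0)) \<longlongrightarrow> r) at_top"
  proof (rule log_rate_limit)
    show "0 < a * d * (c \<bullet> w)" using ab de \<open>0 < c \<bullet> w\<close> by simp
    fix t :: real assume t: "0 < t"
    have "a * d * exp (r * t) * (c \<bullet> w) = (\<Sum>i\<in>UNIV. c $ i * (a * d * exp (r * t) * w $ i))"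
      by (simp add: inner_vec_def sum_distrib_left mult_ac)
    also have "\<dots> \<le> seq_output A c \<alpha> t u\<^sub>1 u\<^sub>2 x0"
      unfolding seq_output_def inner_vec_def
      by (auto intro!: sum_mono mult_left_mono bounds t simp: assms less_imp_le)
    finally show "a * d * (c \<bullet> w) * exp (r * t) \<le> seq_output A c \<alpha> t u\<^sub>1 u\<^sub>2 x0" by (simp add: mult_ac)
    have "seq_output A c \<alpha> t u\<^sub>1 u\<^sub>2 x0 \<le> (\<Sum>i\<in>UNIV. c $ i * (b * e * exp (r * t) * w $ i))"
      unfolding seq_output_def inner_vec_def
      by (auto intro!: sum_mono mult_left_mono bounds t simp: assms less_imp_le)
    also have "\<dots> = b * e * (c \<bullet> w) * exp (r * t)"
      by (simp add: inner_vec_def sum_distrib_left mult_ac)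
    finally show "seq_output A c \<alpha> t u\<^sub>1 u\<^sub>2 x0 \<le> b * e * (c \<bullet> w) * exp (r * t)" .
  qed
  then show ?thesis by (simp add: r_def l_def m_def)
qed

end
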